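(* For every integer $k\ge 3$ there are a $k$-ary relation $E_k(x_1,\ldots,x_k)$ on $\mathbb{R}$ (so $x_1,\ldots,x_k$ are single variables) definable in $\mathbb{R}_{\exp}$, a constant $C_k>0$ and $n_k\in\mathbb{N}$ such that, for each natural number $n>n_k$, there is a sequence $\vec a_n$ in $\mathbb{R}$ of length $n$ that does not contain an $E_k$-indiscernible subsequence of length greater than $C_k\log\log\cdots\log n$, with $k-2$ iterations of $\log$.
   Context: $\mathbb{R}_{\exp}=(\mathbb{R},+,\times,e^x)$ is the real field expanded by the exponential function. $\log$ means logarithm with base $2$. For a $k$-ary relation $E\subseteq X^k$ on a set $X$, a finite sequence $(a_i:1\le i\le m)$ in $X$ with $m \geq k$ is $E$-indiscernible if either $E$ holds on all $k$-tuples $(a_{i_1},\ldots,a_{i_k})$ with $1\le i_1<\cdots<i_k\le m$, or $E$ fails on all such $k$-tuples. *)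

theory Defs
  imports Complex_Main "HOL-Library.Sublist"
begin

datatype exp_term =
    Var nat
  | Plus exp_term exp_term
  | Times exp_term exp_term
  | Expo exp_term

datatype exp_formula =
    Eq exp_term exp_term
  | Neg exp_formula
  | And exp_formula exp_formula
  | Exists nat exp_formula

primrec eval_term :: "(nat \<Rightarrow> real) \<Rightarrow> exp_term \<Rightarrow> real" where
  "eval_term e (Var i) = e i"
| "eval_term e (Plus s t) = eval_term e s + eval_term e t"
| "eval_term e (Times s t) = eval_term e s * eval_term e t"
| "eval_term e (Expo t) = exp (eval_term e t)"

primrec holds :: "(nat \<Rightarrow> real) \<Rightarrow> exp_formula \<Rightarrow> bool" where
  "holds e (Eq s t) \<longleftrightarrow> eval_term e s = eval_term e t"
| "holds e (Neg p) \<longleftrightarrow> \<not> holds e p"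
| "holds e (And p q) \<longleftrightarrow> holds e p \<and> holds e q"
| "holds e (Exists i p) \<longleftrightarrow> (\<exists>r. holds (e(i := r)) p)"

(* A relation of arity k on a set is a set of lists of length k.
   Definable means definable with parameters: in the formula, the variables
   0, ..., k - 1 are x_1, ..., x_k, and a free variable i >= k is a parameter,
   with value b i.  (Only finitely many values of b matter, those at the
   variables that occur in the formula.) *)
definition definable_in_Rexp :: "nat \<Rightarrow> real list set \<Rightarrow> bool" where
  "definable_in_Rexp k E \<longleftrightarrow>
     (\<exists>p b. E = {xs. length xs = k \<and> holds (\<lambda>i. if i < k then xs ! i else b i) p})"

(* The lists xs with subseq xs as and length xs = k are exactly the tuples
   (a_{i_1}, ..., a_{i_k}) with i_1 < ... < i_k: subseq is the relation of being
   a not necessarily contiguous subsequence. *)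
definition indiscernible :: "nat \<Rightarrow> 'a list set \<Rightarrow> 'a list \<Rightarrow> bool" where
  "indiscernible k E as \<longleftrightarrow> k \<le> length as \<and>
     ((\<forall>xs. subseq xs as \<and> length xs = k \<longrightarrow> xs \<in> E) \<or>
      (\<forall>xs. subseq xs as \<and> length xs = k \<longrightarrow> xs \<notin> E))"

end

theory Submission imports Defs begin

text \<open>
  The proof is the stepping-up construction of Erdos and Hajnal, carried out inside the real line
  with the exponential function as coding device.  Let \<open>c\<^sub>1 < \<dots> < c\<^sub>m\<close> be reals at mutual distance at
  least \<open>4\<close>, and consider the \<open>2\<^sup>m\<close> sums of \<open>exp c\<close> over subsets of them.  The numbers \<open>exp c\<close> grow so fast
  that the distance of two such sums is almost \<open>exp c\<close>, where \<open>c\<close> is the largest number on which the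
  two subsets differ; this \<open>c\<close> is the level of the pair.  So the level can be read off, with a
  bounded error, as the logarithm of the distance, which is definable.  Levels behave as in
  a binary tree: for \<open>x < y < z\<close> the levels of \<open>(x, y)\<close> and \<open>(y, z)\<close> differ, and the level of
  \<open>(x, z)\<close> is the larger one (\<open>level_neq\<close>, \<open>level_trans\<close>).

  The relations \<open>step_rel j\<close>, of arity \<open>j + 3\<close>, are defined by recursion.  A triple satisfies the first
  one if its two levels increase.  A longer tuple satisfies the next one if its levels, read
  forwards or backwards, satisfy the previous one, or if they start with a peak.
  Consider an indiscernible sequence of subset sums.  A peak among its levels would give a tuple in
  the relation and a valley a tuple outside it, so one of the two does not occur, and the levels
  form two monotone runs.  By the tree property every subsequence of a monotone run consists of the
  levels of some tuple, so each run, read upwards, is an indiscernible sequence for the previous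
  relation, within the list of the \<open>c\<^sub>i\<close>.  Thus \<open>m\<close> points with indiscernible subsequences of length at most \<open>s\<close> yield
  \<open>2\<^sup>m\<close> points with indiscernible subsequences of length at most about \<open>2s\<close>
  (\<open>indisc_bound_Suc\<close>); every step costs one logarithm and changes the constant.  In the
  initial case, an indiscernible sequence for \<open>step_rel 0\<close> has monotone levels, which leaves room for
  at most \<open>m + 1\<close> of \<open>2\<^sup>m\<close> points (\<open>indisc_bound_0\<close>).

  The relations have to tolerate the error in the levels.  The induction therefore carries along
  that the truth value of \<open>step_rel j\<close> on tuples of the sequence does not change when every
  entry moves by at most \<open>1\<close> (\<open>robust\<close>).  This passes to the subset sums because
  their distances are large compared to \<open>1\<close> (\<open>close_level\<close>, \<open>step_rel_Suc_close\<close>).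
\<close>

section \<open>The relations\<close>

fun steps :: "('a \<Rightarrow> 'a \<Rightarrow> 'b) \<Rightarrow> 'a list \<Rightarrow> 'b list" where
  "steps f (x # y # zs) = f x y # steps f (y # zs)"
| "steps f _ = []"

abbreviation log_gaps :: "real list \<Rightarrow> real list" where
  "log_gaps \<equiv> steps (\<lambda>x y. ln (y - x))"

text \<open>
  The last disjunct tells peaks from valleys: \<open>step_rel j\<close> contains increasing tuples only, so that
  tuples whose gaps start with a peak satisfy \<open>step_rel (Suc j)\<close>, while those whose gaps start
  with a valley violate it.
\<close>

primrec step_rel :: "nat \<Rightarrow> real list \<Rightarrow> bool" where
  "step_rel 0 xs \<longleftrightarrow> length xs = 3 \<and> sorted_wrt (<) xs \<and> log_gaps xs ! 0 < log_gaps xs ! 1"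
| "step_rel (Suc j) xs \<longleftrightarrow> length xs = j + 4 \<and> sorted_wrt (<) xs \<and>
     (step_rel j (log_gaps xs) \<or> step_rel j (rev (log_gaps xs)) \<or>
      (log_gaps xs ! 0 < log_gaps xs ! 1 \<and> log_gaps xs ! 2 < log_gaps xs ! 1))"

lemma step_rel_sorted: "step_rel j xs \<Longrightarrow> sorted_wrt (<) xs"
  and step_rel_length: "step_rel j xs \<Longrightarrow> length xs = j + 3"
  by (cases j; simp)+

lemma length_steps [simp]: "length (steps f xs) = length xs - 1"
  by (induction f xs rule: steps.induct) auto

lemma nth_steps: "Suc i < length xs \<Longrightarrow> steps f xs ! i = f (xs ! i) (xs ! Suc i)"
proof (induction f xs arbitrary: i rule: steps.induct)
  case (1 f x y zs)
  then show ?case by (cases i) auto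
qed auto

lemma steps_map_upt: "steps f (map e [v..<Suc (v + m)]) = map (\<lambda>i. f (e (v + i)) (e (Suc (v + i)))) [0..<m]"
proof (rule nth_equalityI)
  fix i assume "i < length (steps f (map e [v..<Suc (v + m)]))"
  then have "i < m" by simp
  then show "steps f (map e [v..<Suc (v + m)]) ! i = map (\<lambda>i. f (e (v + i)) (e (Suc (v + i)))) [0..<m] ! i"
    by (subst nth_steps) (auto simp del: upt_Suc)
qed (simp del: upt_Suc)

lemma steps_take: "steps f (take (Suc n) xs) = take n (steps f xs)"
  by (rule nth_equalityI) (auto simp: nth_steps less_diff_conv)

lemma steps_drop: "steps f (drop n xs) = drop n (steps f xs)"
  by (rule nth_equalityI) (auto simp: nth_steps)

section \<open>Definability\<close>

text \<open>
  Definability as a property of predicates on assignments, so that closure properties replace the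
  manipulation of formulas and of their bound variables.
\<close>

definition definable_pred :: "((nat \<Rightarrow> real) \<Rightarrow> bool) \<Rightarrow> bool" where
  "definable_pred Q \<longleftrightarrow> (\<exists>p. \<forall>e. holds e p \<longleftrightarrow> Q e)"

lemma definable_pred_eq: "definable_pred (\<lambda>e. eval_term e s = eval_term e t)"
  unfolding definable_pred_def by (rule exI[of _ "Eq s t"]) simp

lemma definable_pred_not: "definable_pred Q \<Longrightarrow> definable_pred (\<lambda>e. \<not> Q e)"
  unfolding definable_pred_def by (metis holds.simps(2))

lemma definable_pred_conj:
  "definable_pred Q \<Longrightarrow> definable_pred R \<Longrightarrow> definable_pred (\<lambda>e. Q e \<and> R e)"
  unfolding definable_pred_def by (metis holds.simps(3))

lemma definable_pred_disj:
  assumes "definable_pred Q" "definable_pred R"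
  shows "definable_pred (\<lambda>e. Q e \<or> R e)"
  using definable_pred_not[OF definable_pred_conj[OF assms[THEN definable_pred_not]]] by simp

lemma definable_pred_ex: "definable_pred Q \<Longrightarrow> definable_pred (\<lambda>e. \<exists>r. Q (e(i := r)))"
  unfolding definable_pred_def by (metis holds.simps(4))

text \<open>
  The order is definable because the positive reals are the values of the exponential function.
\<close>

lemma definable_pred_less: "definable_pred (\<lambda>e. e a < e b)"
proof -
  let ?u = "Suc (a + b)"
  have "definable_pred (\<lambda>e. \<exists>r. eval_term (e(?u := r)) (Plus (Expo (Var ?u)) (Var a))
                             = eval_term (e(?u := r)) (Var b))"
    by (rule definable_pred_ex[OF definable_pred_eq])
  moreover have "(\<exists>r. exp r + x = y) \<longleftrightarrow> x < y" for x y :: real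
  proof
    assume "x < y"
    then have "exp (ln (y - x)) + x = y" by simp
    then show "\<exists>r. exp r + x = y" ..
  qed (metis exp_gt_zero less_add_same_cancel2)
  ultimately show ?thesis by simp
qed

lemma definable_pred_ball_less:
  "(\<And>i. i < m \<Longrightarrow> definable_pred (Q i)) \<Longrightarrow> definable_pred (\<lambda>e. \<forall>i<m. Q i e)" for m :: nat
proof (induction m)
  case 0
  then show ?case using definable_pred_eq[of "Var 0" "Var 0"] by simp
next
  case (Suc m)
  have "definable_pred (\<lambda>e. Q m e \<and> (\<forall>i<m. Q i e))"
    using Suc by (intro definable_pred_conj) auto
  then show ?case by (simp add: All_less_Suc)
qed

text \<open>
  Quantification over a whole tuple, whose entries occupy a block of \<open>m\<close> consecutive variables.
\<close>

lemma definable_pred_ex_block: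
  assumes "definable_pred Q"
  shows "definable_pred (\<lambda>e. \<exists>e'. (\<forall>i. i \<notin> {w..<w + m} \<longrightarrow> e' i = e i) \<and> Q e')"
proof (induction m)
  case 0
  have "(\<forall>i. e' i = e i) \<longleftrightarrow> e' = e" for e e' :: "nat \<Rightarrow> real" by auto
  then show ?case using assms by simp
next
  case (Suc m)
  have "(\<exists>r e'. (\<forall>i. i \<notin> {w..<w + m} \<longrightarrow> e' i = (e(w + m := r)) i) \<and> Q e') \<longleftrightarrow>
        (\<exists>e'. (\<forall>i. i \<notin> {w..<w + Suc m} \<longrightarrow> e' i = e i) \<and> Q e')" for e
  proof (intro iffI; elim exE conjE)
    fix r e' assume "\<forall>i. i \<notin> {w..<w + m} \<longrightarrow> e' i = (e(w + m := r)) i" "Q e'"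
    then show "\<exists>e'. (\<forall>i. i \<notin> {w..<w + Suc m} \<longrightarrow> e' i = e i) \<and> Q e'"
      by (intro exI[of _ e']) auto
  next
    fix e' assume "\<forall>i. i \<notin> {w..<w + Suc m} \<longrightarrow> e' i = e i" "Q e'"
    then show "\<exists>r e'. (\<forall>i. i \<notin> {w..<w + m} \<longrightarrow> e' i = (e(w + m := r)) i) \<and> Q e'"
      by (intro exI[of _ "e' (w + m)"] exI[of _ e']) auto
  qed
  then show ?case using definable_pred_ex[OF Suc.IH, of "w + m"] by simp
qed

lemma sorted_wrt_less_map_upt:
  "sorted_wrt (<) (map e [v..<Suc (v + m)]) \<longleftrightarrow> (\<forall>i<m. e (v + i) < (e (Suc (v + i)) :: real))"
proof -
  have "sorted_wrt (<) (map e [v..<Suc (v + m)]) \<longleftrightarrow> successively (<) (map e [v..<Suc (v + m)])"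
    by (rule successively_conv_sorted_wrt[symmetric]) auto
  also have "\<dots> \<longleftrightarrow> (\<forall>i<m. e (v + i) < e (Suc (v + i)))"
    by (auto simp: successively_conv_nth simp del: upt_Suc)
  finally show ?thesis .
qed

text \<open>
  The logarithms of the gaps are the solutions \<open>d\<close> of equations \<open>exp d + x = y\<close>, and they are bound
  to a block of variables that starts behind the tuple.  A solution exists only if \<open>x < y\<close>; since
  \<open>\<sigma>\<close> reaches every gap, solvability of all the equations says that the tuple increases.  The map
  \<open>\<sigma>\<close> determines in which order the gaps are listed, so that one argument serves for the
  list of gaps and for its reverse.
\<close>

lemma definable_pred_log_gaps:
  assumes R: "definable_pred (\<lambda>e. R (map e [w..<w + m]))"
    and w: "w = Suc (v + m)" and \<sigma>: "\<sigma> ` {..<m} = {..<m}"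
  shows "definable_pred (\<lambda>e. sorted_wrt (<) (map e [v..<Suc (v + m)]) \<and>
           R (map (\<lambda>i. log_gaps (map e [v..<Suc (v + m)]) ! \<sigma> i) [0..<m]))"
proof -
  let ?eqs = "\<lambda>e'. \<forall>i<m. exp (e' (w + i)) + e' (v + \<sigma> i) = e' (Suc (v + \<sigma> i))"
  have "definable_pred (\<lambda>e'. exp (e' (w + i)) + e' (v + \<sigma> i) = e' (Suc (v + \<sigma> i)))" for i
    using definable_pred_eq[of "Plus (Expo (Var (w + i))) (Var (v + \<sigma> i))"
        "Var (Suc (v + \<sigma> i))"] by simp
  then have "definable_pred (\<lambda>e'. ?eqs e' \<and> R (map e' [w..<w + m]))"
    by (intro definable_pred_conj definable_pred_ball_less R)
  then have "definable_pred (\<lambda>e. \<exists>e'. (\<forall>i. i \<notin> {w..<w + m} \<longrightarrow> e' i = e i) \<and>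
              ?eqs e' \<and> R (map e' [w..<w + m]))"
    by (rule definable_pred_ex_block)
  moreover have "(\<exists>e'. (\<forall>i. i \<notin> {w..<w + m} \<longrightarrow> e' i = e i) \<and> ?eqs e' \<and> R (map e' [w..<w + m]))
    \<longleftrightarrow> sorted_wrt (<) (map e [v..<Suc (v + m)]) \<and>
           R (map (\<lambda>i. log_gaps (map e [v..<Suc (v + m)]) ! \<sigma> i) [0..<m])" (is "?L \<longleftrightarrow> ?S \<and> R ?G") for e
  proof -
    let ?g = "\<lambda>i. ln (e (Suc (v + \<sigma> i)) - e (v + \<sigma> i))"
    have \<sigma>_less: "\<sigma> i < m" if "i < m" for i using \<sigma> that by auto
    have G: "?G = map ?g [0..<m]"
      by (auto simp: steps_map_upt \<sigma>_less simp del: upt_Suc)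
    show ?thesis
    proof
      assume ?L
      then obtain e' where e': "\<forall>i. i \<notin> {w..<w + m} \<longrightarrow> e' i = e i" "?eqs e'"
        and Re': "R (map e' [w..<w + m])" by blast
      have eq: "exp (e' (w + i)) = e (Suc (v + \<sigma> i)) - e (v + \<sigma> i)" if "i < m" for i
      proof -
        have "e' (v + \<sigma> i) = e (v + \<sigma> i)" "e' (Suc (v + \<sigma> i)) = e (Suc (v + \<sigma> i))"
          using e'(1) w \<sigma>_less[OF that] by auto
        moreover have "exp (e' (w + i)) + e' (v + \<sigma> i) = e' (Suc (v + \<sigma> i))"
          using e'(2) that by blast
        ultimately show ?thesis by simp
      qed
      have "e (v + i) < e (Suc (v + i))" if "i < m" for i
      proof -
        have "i \<in> \<sigma> ` {..<m}" using \<sigma> that by simp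
        then obtain i' where "i' < m" "i = \<sigma> i'" by auto
        then show ?thesis using eq[of i'] exp_gt_zero[of "e' (w + i')"] by simp
      qed
      then have ?S by (simp add: sorted_wrt_less_map_upt del: upt_Suc)
      have "map e' [w..<w + m] = map ?g [0..<m]"
        by (rule nth_equalityI) (simp_all flip: eq)
      then show "?S \<and> R ?G" using Re' \<open>?S\<close> unfolding G by (simp only: simp_thms)
    next
      assume A: "?S \<and> R ?G"
      let ?e' = "\<lambda>i. if i \<in> {w..<w + m} then ?g (i - w) else e i"
      have pos: "e (v + i) < e (Suc (v + i))" if "i < m" for i
        using A that by (simp add: sorted_wrt_less_map_upt del: upt_Suc)
      have "map ?e' [w..<w + m] = map ?g [0..<m]"
        by (rule nth_equalityI) auto
      moreover have "?eqs ?e'"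
      proof (intro allI impI)
        fix i assume "i < m"
        then have "\<sigma> i < m" by (rule \<sigma>_less)
        then have "v + \<sigma> i \<notin> {w..<w + m}" "Suc (v + \<sigma> i) \<notin> {w..<w + m}" "w + i \<in> {w..<w + m}"
          using w \<open>i < m\<close> by auto
        then show "exp (?e' (w + i)) + ?e' (v + \<sigma> i) = ?e' (Suc (v + \<sigma> i))"
          using pos[OF \<open>\<sigma> i < m\<close>] by (simp only: if_True if_False) simp
      qed
      ultimately show ?L using A unfolding G by (intro exI[of _ ?e']) auto
    qed
  qed
  ultimately show ?thesis by (simp only:)
qed

text \<open>
  The position \<open>v\<close> of the tuple among the variables is arbitrary because the recursion
  applies the previous relation to a block further to the right.
\<close>

lemma definable_step_rel: "definable_pred (\<lambda>e. step_rel j (map e [v..<v + j + 3]))"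
proof (induction j arbitrary: v)
  case 0
  let ?w = "Suc (v + 2)" and ?X = "\<lambda>e :: nat \<Rightarrow> real. map e [v..<Suc (v + 2)]"
  have "definable_pred (\<lambda>e. map e [?w..<?w + 2] ! 0 < map e [?w..<?w + 2] ! 1)"
    using definable_pred_less[of ?w "Suc ?w"] by (simp add: upt_rec)
  then have "definable_pred (\<lambda>e. sorted_wrt (<) (?X e) \<and>
      (\<lambda>ds. ds ! 0 < ds ! 1) (map (\<lambda>i. log_gaps (?X e) ! id i) [0..<2]))"
    by (intro definable_pred_log_gaps[where w = ?w]) auto
  moreover have "map (\<lambda>i. log_gaps (?X e) ! id i) [0..<2] = log_gaps (?X e)" for e
    by (rule nth_equalityI) (simp_all del: upt_Suc)
  moreover have "v + 0 + 3 = Suc (v + 2)" by simp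
  moreover have "length (?X e) = 3" for e by simp
  ultimately show ?case by (simp only: step_rel.simps simp_thms)
next
  case (Suc j)
  let ?m = "j + 3"
  let ?w = "Suc (v + ?m)" and ?X = "\<lambda>e :: nat \<Rightarrow> real. map e [v..<Suc (v + ?m)]"
  let ?peak = "\<lambda>ds :: real list. ds ! 0 < ds ! 1 \<and> ds ! 2 < ds ! 1"
  have IH: "definable_pred (\<lambda>e. step_rel j (map e [?w..<?w + ?m]))"
    using Suc.IH[of ?w] by (simp only: add.assoc)
  have "definable_pred (\<lambda>e. e (?w + 0) < e (?w + 1) \<and> e (?w + 2) < e (?w + 1))"
    by (intro definable_pred_conj definable_pred_less)
  then have "definable_pred (\<lambda>e. ?peak (map e [?w..<?w + ?m]))"
    by (simp del: upt_Suc)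
  from definable_pred_disj[OF IH this]
  have *: "definable_pred (\<lambda>e. sorted_wrt (<) (?X e) \<and>
      (\<lambda>ds. step_rel j ds \<or> ?peak ds) (map (\<lambda>i. log_gaps (?X e) ! id i) [0..<?m]))"
    by (intro definable_pred_log_gaps[where w = ?w]) auto
  have "(\<lambda>i. ?m - Suc i) ` {..<?m} = {..<?m}"
  proof (intro equalityI subsetI)
    fix x assume "x \<in> {..<?m}"
    then show "x \<in> (\<lambda>i. ?m - Suc i) ` {..<?m}"
      by (intro image_eqI[of _ _ "?m - Suc x"]) auto
  qed auto
  from definable_pred_log_gaps[OF IH refl this]
  have **: "definable_pred (\<lambda>e. sorted_wrt (<) (?X e) \<and>
      step_rel j (map (\<lambda>i. log_gaps (?X e) ! (?m - Suc i)) [0..<?m]))" .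
  have ids: "map (\<lambda>i. log_gaps (?X e) ! id i) [0..<?m] = log_gaps (?X e)" for e
    by (rule nth_equalityI) (auto simp del: upt_Suc)
  have revs: "map (\<lambda>i. log_gaps (?X e) ! (?m - Suc i)) [0..<?m] = rev (log_gaps (?X e))" for e
    by (rule nth_equalityI) (auto simp: rev_nth simp del: upt_Suc)
  have "length (?X e) = j + 4" for e by simp
  then have split: "step_rel (Suc j) (?X e) \<longleftrightarrow>
      (sorted_wrt (<) (?X e) \<and> (step_rel j (log_gaps (?X e)) \<or> ?peak (log_gaps (?X e)))) \<or>
      (sorted_wrt (<) (?X e) \<and> step_rel j (rev (log_gaps (?X e))))" for e
    unfolding step_rel.simps by blast
  have "v + Suc j + 3 = Suc (v + ?m)" by simp
  then show ?case
    using definable_pred_disj[OF * **] by (simp only: split ids revs)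
qed

lemma definable_in_Rexp_step_rel: "definable_in_Rexp (j + 3) {xs. step_rel j xs}"
proof -
  have "definable_pred (\<lambda>e. step_rel j (map e [0..<j + 3]))"
    using definable_step_rel[of j 0] by (simp only: add_0)
  then obtain p where p: "\<And>e. holds e p \<longleftrightarrow> step_rel j (map e [0..<j + 3])"
    unfolding definable_pred_def by blast
  have eq: "map (\<lambda>i. if i < j + 3 then xs ! i else b i) [0..<j + 3] = xs"
    if "length xs = j + 3" for xs :: "real list" and b
    by (rule nth_equalityI) (simp_all add: that del: upt_Suc)
  have "xs \<in> {xs. step_rel j xs} \<longleftrightarrow> xs \<in> {xs. length xs = j + 3 \<and>
      holds (\<lambda>i. if i < j + 3 then xs ! i else (\<lambda>_. 0) i) p}" for xs
    unfolding p mem_Collect_eq using eq[of xs "\<lambda>_. 0"] step_rel_length[of j xs] by metis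
  then show ?thesis unfolding definable_in_Rexp_def by (intro exI) (rule set_eqI)
qed

section \<open>Lists and subsequences\<close>

lemma set_subseq: "subseq xs ys \<Longrightarrow> set xs \<subseteq> set ys"
  by (auto elim: list_emb_set)

lemma sorted_wrt_subseq: "subseq xs ys \<Longrightarrow> sorted_wrt R ys \<Longrightarrow> sorted_wrt R xs"
  by (induction rule: list_emb.induct) (use set_subseq in auto)

lemma subseq_rev: "subseq xs ys \<Longrightarrow> subseq (rev xs) (rev ys)"
  by (induction rule: list_emb.induct) (auto intro: list_emb_append_mono)

lemma subseq_take: "subseq (take n xs) xs"
  by (intro prefix_imp_subseq take_is_prefix)

lemma subseq_drop: "subseq (drop n xs) xs"
  by (intro suffix_imp_subseq suffix_drop)

text \<open>
  With \<open>R\<close> the order \<open><\<close>, a list without peaks falls and then rises; with \<open>R\<close> the order \<open>>\<close>, a list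
  without valleys rises and then falls.
\<close>

lemma split_if_no_turn:
  assumes R: "\<And>x y. x \<noteq> y \<Longrightarrow> R x y \<longleftrightarrow> \<not> R y x"
    and "distinct_adj D"
    and "\<And>i. Suc (Suc i) < length D \<Longrightarrow> R (D ! i) (D ! Suc i) \<Longrightarrow> \<not> R (D ! Suc (Suc i)) (D ! Suc i)"
  shows "\<exists>A B. D = A @ B \<and> successively (\<lambda>x y. R y x) A \<and> successively R B"
  using assms(2,3)
proof (induction D)
  case (Cons x D)
  have "distinct_adj D" using Cons.prems(1) by (rule distinct_adj_ConsD)
  moreover have "\<And>i. Suc (Suc i) < length D \<Longrightarrow> R (D ! i) (D ! Suc i) \<Longrightarrow> \<not> R (D ! Suc (Suc i)) (D ! Suc i)"
    using Cons.prems(2)[of "Suc _"] by auto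
  ultimately obtain A B where D: "D = A @ B"
    and A: "successively (\<lambda>x y. R y x) A" and B: "successively R B"
    using Cons.IH by blast
  show ?case
  proof (cases "D = [] \<or> R (hd D) x")
    case True
    show ?thesis
    proof (cases A)
      case Nil
      then show ?thesis using D B by (intro exI[of _ "[x]"] exI[of _ B]) auto
    next
      case (Cons a A')
      then show ?thesis using True D A B by (intro exI[of _ "x # A"] exI[of _ B]) auto
    qed
  next
    case False
    then obtain d D' where d: "D = d # D'" by (cases D) auto
    then have "x \<noteq> d" using Cons.prems(1) by simp
    then have "R x d" using False d R[of x d] by simp
    have "successively R D"
    proof (cases D')
      case (Cons d' D'')
      then have "\<not> R d' d" using Cons.prems(2)[of 0] d \<open>R x d\<close> by simp
      moreover have "d \<noteq> d'" using \<open>distinct_adj D\<close> d Cons by simp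
      ultimately have "R d d'" using R by blast
      show ?thesis
      proof (cases A)
        case Nil
        then show ?thesis using D B by simp
      next
        case (Cons a A')
        then have "A' = []" using A D d \<open>D' = d' # D''\<close> \<open>\<not> R d' d\<close> by (cases A') auto
        then show ?thesis using Cons D d \<open>D' = d' # D''\<close> B \<open>R d d'\<close>
          by (auto simp: successively_Cons)
      qed
    qed (use d in simp)
    then show ?thesis using \<open>R x d\<close> d by (intro exI[of _ "[]"] exI[of _ "x # D"]) auto
  qed
qed simp

section \<open>Sets of points whose distances have levels\<close>

text \<open>
  The fractions come from the geometric series: when the levels are at least \<open>4\<close> apart, the
  exponentials of the levels below \<open>c\<close> add up to at most \<open>exp c\<close> times
  \<open>1/16 + 1/16\<^sup>2 + \<dots> = 1/15\<close>.
\<close>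

definition at_level :: "real \<Rightarrow> real \<Rightarrow> bool" where
  "at_level c d \<longleftrightarrow> 14/15 * exp c \<le> d \<and> d \<le> 16/15 * exp c"

lemma exp_four_ge: "16 \<le> exp (4::real)"
proof -
  have "(2::real) ^ 4 \<le> exp 1 ^ 4"
    using exp_ge_add_one_self[of 1] by (intro power_mono) auto
  then show ?thesis by (simp flip: exp_of_nat_mult)
qed

lemma exp_spaced: "16 * exp c \<le> exp c'" if "c + 4 \<le> c'" for c c' :: real
proof -
  have "exp c * 16 \<le> exp c * exp 4" using exp_four_ge by simp
  also have "\<dots> = exp (c + 4)" by (simp add: exp_add)
  also have "\<dots> \<le> exp c'" using that by simp
  finally show ?thesis by simp
qed

abbreviation close :: "real \<Rightarrow> real \<Rightarrow> bool" where
  "close x y \<equiv> \<bar>x - y\<bar> \<le> 1"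

text \<open>
  \<open>C\<close> is the set of levels and \<open>P\<close> the set of points.  Of the construction of \<open>P\<close> from \<open>C\<close>, the
  combinatorics below only needs that every distance in \<open>P\<close> has a level in \<open>C\<close>.
\<close>

locale levels =
  fixes C P :: "real set"
  assumes C_spaced: "c \<in> C \<Longrightarrow> c' \<in> C \<Longrightarrow> c < c' \<Longrightarrow> c + 4 \<le> c'"
    and C_large: "c \<in> C \<Longrightarrow> 4 \<le> c"
    and P_level: "x \<in> P \<Longrightarrow> y \<in> P \<Longrightarrow> x < y \<Longrightarrow> \<exists>c\<in>C. at_level c (y - x)"
begin

definition level :: "real \<Rightarrow> real \<Rightarrow> real" where
  "level x y = (SOME c. c \<in> C \<and> at_level c (y - x))"

lemma level:
  assumes "x \<in> P" "y \<in> P" "x < y"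
  shows "level x y \<in> C" "at_level (level x y) (y - x)"
  using someI_ex[of "\<lambda>c. c \<in> C \<and> at_level c (y - x)"] P_level[OF assms]
  unfolding level_def by blast+

lemma C_eq_or_exp_spaced:
  assumes "c \<in> C" "c' \<in> C"
  obtains "c = c'" | "c < c'" "16 * exp c \<le> exp c'" | "c' < c" "16 * exp c' \<le> exp c"
  using assms C_spaced exp_spaced by (meson linorder_neqE_linordered_idom)

text \<open>
  Otherwise \<open>z - x\<close> would be about twice the exponential of a level, which is too far from the
  exponential of any level.
\<close>

lemma level_neq:
  assumes "x \<in> P" "y \<in> P" "z \<in> P" "x < y" "y < z"
  shows "level x y \<noteq> level y z"
proof
  let ?c = "level x z"
  assume eq: "level x y = level y z"
  have d: "at_level (level x y) (y - x)" "at_level (level x y) (z - y)" "at_level ?c (z - x)"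
    and C: "level x y \<in> C" "?c \<in> C"
    using level[of x y] level[of y z] level[of x z] assms eq by auto
  show False
    using C by (rule C_eq_or_exp_spaced)
      (use d exp_gt_zero[of "level x y"] exp_gt_zero[of ?c] in \<open>simp_all add: at_level_def\<close>)
qed

text \<open>
  The distance of the larger level dominates the sum \<open>(z - y) + (y - x)\<close>, the other one being smaller
  by a factor of about \<open>16\<close>.
\<close>

lemma level_trans:
  assumes "x \<in> P" "y \<in> P" "z \<in> P" "x < y" "y < z"
  shows "level x z = max (level x y) (level y z)"
proof -
  let ?a = "level x y" and ?b = "level y z" and ?c = "level x z"
  have d: "at_level ?a (y - x)" "at_level ?b (z - y)" "at_level ?c (z - x)"
    and C: "?a \<in> C" "?b \<in> C" "?c \<in> C"
    using level[of x y] level[of y z] level[of x z] assms by auto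
  note pos = exp_gt_zero[of ?a] exp_gt_zero[of ?b] exp_gt_zero[of ?c]
  have "?c = ?b" if "?a < ?b"
    using C(3,2)
    by (rule C_eq_or_exp_spaced) (use d pos exp_spaced[OF C_spaced[OF C(1,2) that]] in \<open>simp_all add: at_level_def\<close>)
  moreover have "?c = ?a" if "?b < ?a"
    using C(3,1)
    by (rule C_eq_or_exp_spaced) (use d pos exp_spaced[OF C_spaced[OF C(2,1) that]] in \<open>simp_all add: at_level_def\<close>)
  moreover have "?a \<noteq> ?b" using level_neq assms by blast
  ultimately show ?thesis by (auto simp: max_def)
qed

text \<open>
  Distances in \<open>P\<close> are at least \<open>14/15 * 16\<close>, so that moving both endpoints by at most \<open>1\<close> changes them by a
  small fraction.  The new distance is within a factor \<open>2 \<le> exp 1\<close> of the exponential of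
  the level.
\<close>

lemma close_level:
  assumes "x \<in> P" "y \<in> P" "x < y" "close x x'" "close y y'"
  shows "x' < y'" "close (level x y) (ln (y' - x'))"
proof -
  let ?c = "level x y"
  have "16 \<le> exp ?c" using C_large[OF level(1)[OF assms(1-3)]] exp_four_ge
    by (meson exp_le_cancel_iff order_trans)
  then have b: "exp ?c / 2 \<le> y' - x'" "y' - x' \<le> exp ?c * 2"
    using level(2)[OF assms(1-3)] assms(4,5) unfolding at_level_def by linarith+
  then show "x' < y'" using exp_gt_zero[of ?c] by linarith
  have e: "2 \<le> exp (1::real)" using exp_ge_add_one_self[of 1] by simp
  have "exp (?c - 1) * 2 \<le> exp (?c - 1) * exp 1" "exp ?c * 2 \<le> exp ?c * exp 1"
    using e by (intro mult_left_mono; simp)+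
  then have "exp (?c - 1) \<le> exp ?c / 2" "exp ?c * 2 \<le> exp (?c + 1)"
    by (simp_all flip: exp_add)
  then have "ln (exp (?c - 1)) \<le> ln (y' - x')" "ln (y' - x') \<le> ln (exp (?c + 1))"
    using b \<open>x' < y'\<close> by (subst ln_le_cancel_iff; simp)+
  then show "close ?c (ln (y' - x'))" by simp
qed

lemma levels_close:
  assumes "sorted_wrt (<) xs" "set xs \<subseteq> P" "list_all2 close xs ys"
  shows "sorted_wrt (<) ys" "list_all2 close (steps level xs) (log_gaps ys)"
proof -
  have len: "length xs = length ys" and cl: "\<And>i. i < length xs \<Longrightarrow> close (xs ! i) (ys ! i)"
    using assms(3) by (auto simp: list_all2_conv_all_nth)
  have P: "xs ! i \<in> P" "xs ! Suc i \<in> P" "xs ! i < xs ! Suc i" if "Suc i < length xs" for i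
    using assms(1,2) that nth_mem[of i xs] nth_mem[of "Suc i" xs] by (auto simp: sorted_wrt_iff_nth_less)
  have ys: "ys ! i < ys ! Suc i" "close (level (xs ! i) (xs ! Suc i)) (ln (ys ! Suc i - ys ! i))"
    if "Suc i < length xs" for i
    using close_level[OF P[OF that] cl cl] that by auto
  then have "successively (<) ys"
    by (simp add: successively_conv_nth len)
  then show "sorted_wrt (<) ys"
    by (subst (asm) successively_conv_sorted_wrt) auto
  show "list_all2 close (steps level xs) (log_gaps ys)"
    unfolding list_all2_conv_all_nth using ys len by (simp add: nth_steps less_diff_conv)
qed

lemma set_steps_level:
  "sorted_wrt (<) xs \<Longrightarrow> set xs \<subseteq> P \<Longrightarrow> set (steps level xs) \<subseteq> C"
  by (induction level xs rule: steps.induct) (auto simp: level)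

lemma steps_level_neq:
  "sorted_wrt (<) xs \<Longrightarrow> set xs \<subseteq> P \<Longrightarrow> distinct_adj (steps level xs)"
proof (induction xs rule: induct_list012)
  case (3 x y zs)
  then show ?case using level_neq[of x y] by (cases zs) auto
qed auto

text \<open>
  Different levels are \<open>4\<close> apart, hence still separated after errors of \<open>1\<close>.
\<close>

lemma close_less_iff:
  assumes "c \<in> C" "c' \<in> C" "c \<noteq> c'" "close c d" "close c' d'"
  shows "d < d' \<longleftrightarrow> c < c'"
  using C_spaced[of c c'] C_spaced[of c' c] assms by linarith

lemma close_sorted_iff:
  assumes "list_all2 close cs ds" "set cs \<subseteq> C" "distinct_adj cs"
  shows "sorted_wrt (<) ds \<longleftrightarrow> sorted_wrt (<) cs"
proof -
  have "successively (<) ds \<longleftrightarrow> successively (<) cs"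
    using assms
  proof (induction cs ds rule: list_all2_induct)
    case (Cons c cs d ds)
    then show ?case using close_less_iff[of c _ d]
      by (cases cs; cases ds) auto
  qed simp
  then show ?thesis by (simp add: successively_conv_sorted_wrt)
qed

text \<open>
  Keep the first point and, for each level to be realised, the right endpoint of its step.  The steps
  skipped in between have smaller levels, so that by \<open>level_trans\<close> they do not affect
  the level of the merged step.
\<close>

lemma lift_increasing_levels:
  assumes "sorted_wrt (<) ws" "set ws \<subseteq> P" "ws \<noteq> []"
    and "sorted_wrt (<) (steps level ws)" "subseq es (steps level ws)"
  shows "\<exists>xs. subseq (hd ws # xs) ws \<and> steps level (hd ws # xs) = es"
  using assms
proof (induction ws arbitrary: es rule: induct_list012)
  case (2 x)
  then show ?case by (cases es) (auto intro: exI[of _ "[]"])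
next
  case (3 x y zs)
  from \<open>subseq es (steps level (x # y # zs))\<close>
  consider es' where "es = level x y # es'" "subseq es' (steps level (y # zs))"
    | "subseq es (steps level (y # zs))"
    by (cases es) (auto split: if_splits)
  then show ?case
  proof cases
    case 1
    then obtain xs where "subseq (y # xs) (y # zs)" "steps level (y # xs) = es'"
      using 3 by auto
    then show ?thesis using 1 by (intro exI[of _ "y # xs"]) auto
  next
    case 2
    then obtain xs where xs: "subseq (y # xs) (y # zs)" "steps level (y # xs) = es"
      using 3 by auto
    have "subseq (x # xs) (x # y # zs)" using xs(1) by auto
    moreover have "steps level (x # xs) = es"
    proof (cases xs)
      case (Cons z xs')
      have "z \<in> set zs" using xs(1) Cons
        by (metis list.set_intros(1) subseq_Cons2_iff set_subseq subsetD)
      then have "x \<in> P" "y \<in> P" "z \<in> P" "x < y" "y < z" using 3(3,4) by auto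
      moreover have "level x y < level y z"
      proof -
        have "level y z \<in> set es" using xs(2) Cons by auto
        then have "level y z \<in> set (steps level (y # zs))" using set_subseq[OF 2] by blast
        then show ?thesis using 3(6) by simp
      qed
      ultimately show ?thesis using level_trans[of x y z] xs(2) Cons by simp
    qed (use xs in simp)
    ultimately show ?thesis by auto
  qed
qed simp

lemma level_less_if_step_levels_less:
  assumes "sorted_wrt (<) (y # zs)" "set (y # zs) \<subseteq> P" "\<forall>d\<in>set (steps level (y # zs)). d < c"
    and "w \<in> set zs"
  shows "level y w < c"
  using assms
proof (induction zs arbitrary: y)
  case (Cons z zs)
  show ?case
  proof (cases "w = z")
    case False
    then have "level z w < c" using Cons by auto
    then show ?thesis using level_trans[of y z w] Cons.prems False by auto
  qed (use Cons in auto)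
qed simp

text \<open>
  The mirror image of the previous lemma: keep the left endpoints of the steps and
  the last point.
\<close>

lemma lift_decreasing_levels:
  assumes "sorted_wrt (<) ws" "set ws \<subseteq> P" "ws \<noteq> []"
    and "sorted_wrt (>) (steps level ws)" "subseq es (steps level ws)"
  shows "\<exists>xs. xs \<noteq> [] \<and> subseq xs ws \<and> steps level xs = es"
  using assms
proof (induction ws arbitrary: es rule: induct_list012)
  case (2 x)
  then have "es = []" by (cases es) auto
  then show ?case by (intro exI[of _ "[x]"]) auto
next
  case (3 x y zs)
  from \<open>subseq es (steps level (x # y # zs))\<close>
  consider es' where "es = level x y # es'" "subseq es' (steps level (y # zs))"
    | "subseq es (steps level (y # zs))"
    by (cases es) (auto split: if_splits)
  then show ?case
  proof cases
    case 1
    then obtain xs where "xs \<noteq> []" "subseq xs (y # zs)" "steps level xs = es'"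
      using 3 by auto
    then obtain w xs' where xs: "subseq (w # xs') (y # zs)" "steps level (w # xs') = es'"
      by (cases xs) auto
    have "w \<in> set (y # zs)" using xs(1) by (metis list.set_intros(1) set_subseq subsetD)
    have "level x w = level x y"
    proof (cases "w = y")
      case False
      then have "w \<in> set zs" using \<open>w \<in> set (y # zs)\<close> by simp
      moreover have "level y w < level x y"
        using 3(3,4,6) calculation by (intro level_less_if_step_levels_less[of y zs]) auto
      ultimately show ?thesis using level_trans[of x y w] 3(3,4) by auto
    qed simp
    then show ?thesis using 1 xs by (intro exI[of _ "x # w # xs'"]) auto
  next
    case 2
    then obtain xs where "xs \<noteq> []" "subseq xs (y # zs)" "steps level xs = es"
      using 3 by auto
    then show ?thesis by auto
  qed
qed simp

end

section \<open>Sets of subset sums\<close>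

text \<open>
  The properties that a sequence needs in order to serve as the list of levels for the next one.
\<close>

definition spaced :: "real list \<Rightarrow> bool" where
  "spaced xs \<longleftrightarrow> sorted_wrt (\<lambda>x y. x + 4 \<le> y) xs \<and> (\<forall>x\<in>set xs. 4 \<le> x)"

lemma spaced_sorted: "spaced xs \<Longrightarrow> sorted_wrt (<) xs"
  unfolding spaced_def by (auto elim: sorted_wrt_mono_rel[rotated])

text \<open>
  For a list in decreasing order of widely spaced numbers, this lists the sums in increasing order.  The offset
  \<open>4\<close> makes the sums large enough to be levels themselves.
\<close>

fun subset_sums :: "real list \<Rightarrow> real list" where
  "subset_sums [] = [4]"
| "subset_sums (c # cs) = subset_sums cs @ map ((+) (exp c)) (subset_sums cs)"

lemma length_subset_sums: "length (subset_sums cs) = 2 ^ length cs"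
  by (induction cs) auto

lemma sum_exp_le:
  "sorted_wrt (\<lambda>x y. y + 4 \<le> x) (c # cs) \<Longrightarrow> (\<Sum>x\<leftarrow>cs. exp x) \<le> exp (c::real) / 15"
proof (induction cs arbitrary: c)
  case (Cons c' cs)
  then have "(\<Sum>x\<leftarrow>cs. exp x) \<le> exp c' / 15" "16 * exp c' \<le> exp c"
    by (auto intro!: exp_spaced)
  then show ?case by simp
qed simp

lemma subset_sums_bounds:
  "x \<in> set (subset_sums cs) \<Longrightarrow> 4 \<le> x \<and> x \<le> 4 + (\<Sum>c\<leftarrow>cs. exp c)"
proof (induction cs arbitrary: x)
  case (Cons c cs)
  from Cons.prems consider "x \<in> set (subset_sums cs)"
    | y where "y \<in> set (subset_sums cs)" "x = exp c + y" by auto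
  then show ?case
  proof cases
    case 1
    then show ?thesis using Cons.IH[of x] exp_gt_zero[of c] unfolding list.map sum_list.Cons by linarith
  next
    case 2
    then show ?thesis using Cons.IH[of y] exp_gt_zero[of c] unfolding list.map sum_list.Cons by linarith
  qed
qed simp

lemma subset_sums_levels:
  assumes "sorted_wrt (\<lambda>x y. y + 4 \<le> x) cs"
  shows "sorted_wrt (<) (subset_sums cs)"
    and "x \<in> set (subset_sums cs) \<Longrightarrow> y \<in> set (subset_sums cs) \<Longrightarrow> x < y \<Longrightarrow>
           \<exists>c\<in>set cs. at_level c (y - x)"
proof -
  have "sorted_wrt (<) (subset_sums cs) \<and> (\<forall>x\<in>set (subset_sums cs). \<forall>y\<in>set (subset_sums cs).
          x < y \<longrightarrow> (\<exists>c\<in>set cs. at_level c (y - x)))"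
    using assms
  proof (induction cs)
    case (Cons c cs)
    let ?P = "set (subset_sums cs)"
    have small: "(\<Sum>x\<leftarrow>cs. exp x) \<le> exp c / 15" by (rule sum_exp_le[OF Cons.prems])
    have IH: "sorted_wrt (<) (subset_sums cs)"
      "\<And>x y. x \<in> ?P \<Longrightarrow> y \<in> ?P \<Longrightarrow> x < y \<Longrightarrow> \<exists>c\<in>set cs. at_level c (y - x)"
      using Cons by auto
    have across: "x < exp c + y" "at_level c (exp c + y - x)" if "x \<in> ?P" "y \<in> ?P" for x y
      using subset_sums_bounds[OF that(1)] subset_sums_bounds[OF that(2)] small exp_gt_zero[of c]
      unfolding at_level_def by linarith+
    have "sorted_wrt (<) (subset_sums (c # cs))"
      using IH(1) across(1) by (auto simp: sorted_wrt_append sorted_wrt_map)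
    moreover have "\<exists>c'\<in>set (c # cs). at_level c' (y - x)"
      if xy: "x \<in> set (subset_sums (c # cs))" "y \<in> set (subset_sums (c # cs))" "x < y" for x y
    proof -
      from xy(1,2) consider "x \<in> ?P" "y \<in> ?P" | y' where "x \<in> ?P" "y' \<in> ?P" "y = exp c + y'"
        | x' where "x' \<in> ?P" "y \<in> ?P" "x = exp c + x'"
        | x' y' where "x' \<in> ?P" "y' \<in> ?P" "x = exp c + x'" "y = exp c + y'"
        by auto
      then show ?thesis
      proof cases
        case 3
        then show ?thesis using across(1)[of y x'] xy(3) by simp
      qed (use IH(2) across(2) xy(3) in auto)
    qed
    ultimately show ?case by blast
  qed simp
  then show "sorted_wrt (<) (subset_sums cs)"
    and "x \<in> set (subset_sums cs) \<Longrightarrow> y \<in> set (subset_sums cs) \<Longrightarrow> x < y \<Longrightarrow>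
           \<exists>c\<in>set cs. at_level c (y - x)" by blast+
qed

lemma levels_spaced_exist:
  assumes cs: "spaced cs" and n: "n \<le> 2 ^ length cs"
  obtains as where "length as = n" "spaced as" "levels (set cs) (set as)"
proof (rule that)
  let ?as = "take n (subset_sums (rev cs))"
  have rev: "sorted_wrt (\<lambda>x y. y + 4 \<le> x) (rev cs)"
    using cs by (simp add: spaced_def sorted_wrt_rev)
  have sub: "set ?as \<subseteq> set (subset_sums (rev cs))" by (rule set_take_subset)
  have large: "4 \<le> c" if "c \<in> set cs" for c using cs that by (simp add: spaced_def)
  have lev: "\<exists>c\<in>set cs. at_level c (y - x)" if "x \<in> set ?as" "y \<in> set ?as" "x < y" for x y
    using subset_sums_levels(2)[OF rev, of x y] that sub by auto
  show "length ?as = n" using n by (simp add: length_subset_sums)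
  show "levels (set cs) (set ?as)"
  proof (unfold_locales)
    show "c + 4 \<le> c'" if "c \<in> set cs" "c' \<in> set cs" "c < c'" for c c'
    proof -
      have sorted: "\<And>i i'. i < i' \<Longrightarrow> i' < length cs \<Longrightarrow> cs ! i + 4 \<le> cs ! i'"
        using cs by (auto simp: spaced_def sorted_wrt_iff_nth_less)
      from that(1,2) obtain i i' where "i < length cs" "i' < length cs" "cs ! i = c" "cs ! i' = c'"
        unfolding in_set_conv_nth by blast
      then show ?thesis using sorted[of i i'] sorted[of i' i] that(3)
        by (cases i i' rule: linorder_cases) auto
    qed
  qed (use large lev in auto)
  have gap: "x + 4 \<le> y" if "x \<in> set ?as" "y \<in> set ?as" "x < y" for x y
  proof -
    from lev[OF that] obtain c where c: "c \<in> set cs" "at_level c (y - x)" by auto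
    have "16 \<le> exp c" using large[OF c(1)] order_trans[OF exp_four_ge, of "exp c"] by simp
    then show ?thesis using c(2) by (simp add: at_level_def)
  qed
  have "sorted_wrt (<) ?as" by (rule sorted_wrt_take[OF subset_sums_levels(1)[OF rev]])
  then have "sorted_wrt (\<lambda>x y. x + 4 \<le> y) ?as"
    by (rule sorted_wrt_mono_rel[rotated]) (use gap in auto)
  moreover have "\<forall>x\<in>set ?as. 4 \<le> x" using sub subset_sums_bounds by blast
  ultimately show "spaced ?as" by (simp add: spaced_def)
qed

section \<open>Stepping up\<close>

text \<open>
  Within this tolerance the truth value of the relation on a tuple of levels can be computed from
  the logarithms of the distances, although these determine the levels only up to an error of \<open>1\<close>.
\<close>

definition robust :: "nat \<Rightarrow> real list \<Rightarrow> bool" where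
  "robust j as \<longleftrightarrow> (\<forall>xs ys. subseq xs as \<and> length xs = j + 3 \<and> list_all2 close xs ys \<longrightarrow>
     step_rel j ys = step_rel j xs)"

definition indisc_bound :: "nat \<Rightarrow> real \<Rightarrow> real list \<Rightarrow> bool" where
  "indisc_bound j s as \<longleftrightarrow> (\<forall>bs. subseq bs as \<and> indiscernible (j + 3) {xs. step_rel j xs} bs \<longrightarrow>
     real (length bs) \<le> s)"

context levels
begin

lemma close_nth_less_iff:
  assumes "list_all2 close es ds" "set es \<subseteq> C" "i < length es" "i' < length es" "es ! i \<noteq> es ! i'"
  shows "ds ! i < ds ! i' \<longleftrightarrow> es ! i < es ! i'"
proof (rule close_less_iff)
  show "es ! i \<in> C" "es ! i' \<in> C" using assms(2-4) by (auto dest: nth_mem)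
  show "close (es ! i) (ds ! i)" "close (es ! i') (ds ! i')"
    using assms(1,3,4) by (auto simp: list_all2_conv_all_nth)
qed (rule assms(5))

text \<open>
  If \<open>es\<close> increases, it is a subsequence of \<open>cs\<close> and robustness applies.  Otherwise it has a
  descent, which survives in \<open>ds\<close>, and neither list can satisfy the relation.
\<close>

lemma step_rel_close:
  assumes "set cs = C" "sorted_wrt (<) cs" "robust j cs"
    and "list_all2 close es ds" "set es \<subseteq> C" "distinct_adj es" "length es = j + 3"
  shows "step_rel j ds \<longleftrightarrow> step_rel j es"
proof (cases "sorted_wrt (<) es")
  case True
  then have "subseq es cs"
    using assms(1,2,5) by (intro sorted_subset_imp_subseq) (auto elim: sorted_wrt_mono_rel[rotated])
  then show ?thesis using assms(3,4,7) unfolding robust_def by blast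
next
  case False
  moreover have "\<not> sorted_wrt (<) ds" using False close_sorted_iff assms(4-6) by blast
  ultimately show ?thesis using step_rel_sorted by blast
qed

text \<open>
  On tuples of points, and on tuples close to them, the relation depends only on the exact levels.
\<close>

lemma step_rel_Suc_close:
  assumes cs: "set cs = C" "sorted_wrt (<) cs" "robust j cs"
    and xs: "sorted_wrt (<) xs" "set xs \<subseteq> P" "length xs = j + 4" and ys: "list_all2 close xs ys"
  defines "ds \<equiv> steps level xs"
  shows "step_rel (Suc j) ys \<longleftrightarrow>
    step_rel j ds \<or> step_rel j (rev ds) \<or> (ds ! 0 < ds ! 1 \<and> ds ! 2 < ds ! 1)"
proof -
  have d: "sorted_wrt (<) ys" "list_all2 close ds (log_gaps ys)" "set ds \<subseteq> C" "distinct_adj ds"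
      "length ds = j + 3"
    using levels_close[OF xs(1,2) ys] set_steps_level[OF xs(1,2)] steps_level_neq[OF xs(1,2)] xs(3)
    unfolding ds_def by auto
  have "length ys = j + 4" using list_all2_lengthD[OF ys] xs(3) by simp
  have "step_rel j (log_gaps ys) \<longleftrightarrow> step_rel j ds"
    by (rule step_rel_close[OF cs d(2-5)])
  moreover have "step_rel j (rev (log_gaps ys)) \<longleftrightarrow> step_rel j (rev ds)"
    by (rule step_rel_close[OF cs]) (use d in \<open>simp_all add: list_all2_rev\<close>)
  moreover have "log_gaps ys ! 0 < log_gaps ys ! 1 \<longleftrightarrow> ds ! 0 < ds ! 1"
    "log_gaps ys ! 2 < log_gaps ys ! 1 \<longleftrightarrow> ds ! 2 < ds ! 1"
    using distinct_adj_nth[OF d(4), of 0] distinct_adj_nth[OF d(4), of 1] d(5)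
    by (intro close_nth_less_iff[OF d(2,3)]; simp add: numeral_2_eq_2)+
  ultimately show ?thesis using d(1) \<open>length ys = j + 4\<close> by simp
qed

lemma step_rel_0_close:
  assumes xs: "sorted_wrt (<) xs" "set xs \<subseteq> P" "length xs = 3" and ys: "list_all2 close xs ys"
  shows "step_rel 0 ys \<longleftrightarrow> steps level xs ! 0 < steps level xs ! 1"
proof -
  let ?ds = "steps level xs"
  have d: "sorted_wrt (<) ys" "list_all2 close ?ds (log_gaps ys)" "set ?ds \<subseteq> C" "distinct_adj ?ds"
      "length ?ds = 2"
    using levels_close[OF xs(1,2) ys] set_steps_level[OF xs(1,2)] steps_level_neq[OF xs(1,2)] xs(3)
    by auto
  have "log_gaps ys ! 0 < log_gaps ys ! 1 \<longleftrightarrow> ?ds ! 0 < ?ds ! 1"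
    using distinct_adj_nth[OF d(4), of 0] d(5) by (intro close_nth_less_iff[OF d(2,3)]) simp_all
  then show ?thesis using d(1) list_all2_lengthD[OF ys] xs(3) by simp
qed

text \<open>
  \<open>L\<close> stands for a monotone run of levels in \<open>bs\<close>, listed in increasing order: it is the run
  itself or its reverse, and \<open>step_rel (Suc j)\<close> does not distinguish the two cases.  Hence \<open>L\<close>
  inherits indiscernibility from \<open>bs\<close>.  The maximum in the bound covers runs that are too short for
  indiscernibility to make sense.
\<close>

lemma mono_run_bound:
  assumes cs: "set cs = C" "sorted_wrt (<) cs" "robust j cs" "indisc_bound j s cs"
    and bs: "sorted_wrt (<) bs" "set bs \<subseteq> P" "indiscernible (j + 4) {xs. step_rel (Suc j) xs} bs"
    and L: "sorted_wrt (<) L" "set L \<subseteq> C"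
    and lift: "\<And>es. subseq es L \<Longrightarrow> length es = j + 3 \<Longrightarrow>
       \<exists>xs. subseq xs bs \<and> (steps level xs = es \<or> steps level xs = rev es)"
  shows "real (length L) \<le> max s (j + 3)"
proof (cases "length L < j + 3")
  case False
  have *: "\<exists>xs. subseq xs bs \<and> length xs = j + 4 \<and> (step_rel (Suc j) xs \<longleftrightarrow> step_rel j es)"
    if es: "subseq es L" "length es = j + 3" for es
  proof -
    obtain xs where xs: "subseq xs bs" "steps level xs = es \<or> steps level xs = rev es"
      using lift[OF es] by blast
    have "length (steps level xs) = length es" using xs(2) length_rev by metis
    then have len: "length xs = j + 4" using es(2) by simp
    have sP: "sorted_wrt (<) xs" "set xs \<subseteq> P"
      using sorted_wrt_subseq[OF xs(1) bs(1)] set_subseq[OF xs(1)] bs(2) by auto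
    have "sorted_wrt (<) es" by (rule sorted_wrt_subseq[OF es(1) L(1)])
    then have lt: "es ! i < es ! i'" if "i < i'" "i' < j + 3" for i i'
      using that es(2) by (simp add: sorted_wrt_iff_nth_less)
    have "\<not> step_rel j (rev es)"
    proof
      assume "step_rel j (rev es)"
      then have "sorted_wrt (<) (rev es)" by (rule step_rel_sorted)
      then have "rev es ! 0 < rev es ! 1" using es(2) by (simp add: sorted_wrt_iff_nth_less)
      then have "es ! (j + 2) < es ! (j + 1)" using es(2) by (simp add: rev_nth)
      then show False using lt[of "j + 1" "j + 2"] by simp
    qed
    moreover have "\<not> (es ! 0 < es ! 1 \<and> es ! 2 < es ! 1)"
      using lt[of 1 2] by auto
    moreover have "\<not> (rev es ! 0 < rev es ! 1 \<and> rev es ! 2 < rev es ! 1)"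
      using lt[of "j + 1" "j + 2"] es(2) by (simp add: rev_nth)
    moreover have "list_all2 close xs xs" by (simp add: list_all2_refl)
    ultimately have "step_rel (Suc j) xs \<longleftrightarrow> step_rel j es"
      using step_rel_Suc_close[OF cs(1-3) sP len] xs(2) by (auto simp del: step_rel.simps)
    then show ?thesis using xs(1) len by blast
  qed
  have "indiscernible (j + 3) {xs. step_rel j xs} L"
    using bs(3) False * unfolding indiscernible_def mem_Collect_eq by (metis not_less)
  moreover have "subseq L cs"
    using cs(1,2) L by (intro sorted_subset_imp_subseq) (auto elim: sorted_wrt_mono_rel[rotated])
  ultimately show ?thesis using cs(4) unfolding indisc_bound_def by (meson max.coboundedI1)
qed simp

lemma inc_run_bound:
  assumes cs: "set cs = C" "sorted_wrt (<) cs" "robust j cs" "indisc_bound j s cs"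
    and bs: "sorted_wrt (<) bs" "set bs \<subseteq> P" "indiscernible (j + 4) {xs. step_rel (Suc j) xs} bs"
    and ws: "subseq ws bs" "sorted_wrt (<) (steps level ws)"
  shows "real (length (steps level ws)) \<le> max s (j + 3)"
proof (rule mono_run_bound[OF cs bs ws(2)])
  have sP: "sorted_wrt (<) ws" "set ws \<subseteq> P"
    using sorted_wrt_subseq[OF ws(1) bs(1)] set_subseq[OF ws(1)] bs(2) by auto
  show "set (steps level ws) \<subseteq> C" by (rule set_steps_level[OF sP])
  fix es assume es: "subseq es (steps level ws)" "length es = j + 3"
  then have "ws \<noteq> []" by auto
  then obtain xs where "subseq (hd ws # xs) ws" "steps level (hd ws # xs) = es"
    using lift_increasing_levels[OF sP _ ws(2) es(1)] by blast
  then show "\<exists>xs. subseq xs bs \<and> (steps level xs = es \<or> steps level xs = rev es)"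
    using subseq_order.trans ws(1) by blast
qed

lemma dec_run_bound:
  assumes cs: "set cs = C" "sorted_wrt (<) cs" "robust j cs" "indisc_bound j s cs"
    and bs: "sorted_wrt (<) bs" "set bs \<subseteq> P" "indiscernible (j + 4) {xs. step_rel (Suc j) xs} bs"
    and ws: "subseq ws bs" "sorted_wrt (>) (steps level ws)"
  shows "real (length (steps level ws)) \<le> max s (j + 3)"
proof -
  have sP: "sorted_wrt (<) ws" "set ws \<subseteq> P"
    using sorted_wrt_subseq[OF ws(1) bs(1)] set_subseq[OF ws(1)] bs(2) by auto
  have "real (length (rev (steps level ws))) \<le> max s (j + 3)"
  proof (rule mono_run_bound[OF cs bs])
    show "sorted_wrt (<) (rev (steps level ws))" using ws(2) by (simp add: sorted_wrt_rev)
    show "set (rev (steps level ws)) \<subseteq> C" using set_steps_level[OF sP] by simp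
    fix es assume es: "subseq es (rev (steps level ws))" "length es = j + 3"
    have sub: "subseq (rev es) (steps level ws)" using subseq_rev[OF es(1)] by simp
    then have "ws \<noteq> []" using es by auto
    then obtain xs where "subseq xs ws" "steps level xs = rev es"
      using lift_decreasing_levels[OF sP _ ws(2) sub] by blast
    then show "\<exists>xs. subseq xs bs \<and> (steps level xs = es \<or> steps level xs = rev es)"
      using subseq_order.trans ws(1) by blast
  qed
  then show ?thesis by simp
qed

lemma robust_Suc:
  assumes cs: "set cs = C" "sorted_wrt (<) cs" "robust j cs"
    and as: "sorted_wrt (<) as" "set as \<subseteq> P"
  shows "robust (Suc j) as"
  unfolding robust_def
proof (intro allI impI; elim conjE)
  fix xs ys assume xs: "subseq xs as" "length xs = Suc j + 3" "list_all2 close xs ys"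
  have sP: "sorted_wrt (<) xs" "set xs \<subseteq> P" "length xs = j + 4"
    using sorted_wrt_subseq[OF xs(1) as(1)] set_subseq[OF xs(1)] as(2) xs(2) by auto
  have "list_all2 close xs xs" by (simp add: list_all2_refl)
  then show "step_rel (Suc j) ys = step_rel (Suc j) xs"
    using step_rel_Suc_close[OF cs sP] xs(3) by blast
qed

lemma robust_0:
  assumes as: "sorted_wrt (<) as" "set as \<subseteq> P"
  shows "robust 0 as"
  unfolding robust_def
proof (intro allI impI; elim conjE)
  fix xs ys assume xs: "subseq xs as" "length xs = 0 + 3" "list_all2 close xs ys"
  have sP: "sorted_wrt (<) xs" "set xs \<subseteq> P" "length xs = 3"
    using sorted_wrt_subseq[OF xs(1) as(1)] set_subseq[OF xs(1)] as(2) xs(2) by auto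
  have "list_all2 close xs xs" by (simp add: list_all2_refl)
  then show "step_rel 0 ys = step_rel 0 xs"
    using step_rel_0_close[OF sP] xs(3) by blast
qed

text \<open>
  The levels of an indiscernible sequence are monotone, hence distinct.
\<close>

lemma indisc_bound_0:
  assumes fin: "finite C" and as: "sorted_wrt (<) as" "set as \<subseteq> P"
  shows "indisc_bound 0 (card C + 1) as"
  unfolding indisc_bound_def
proof (intro allI impI; elim conjE)
  fix bs assume bs: "subseq bs as" "indiscernible (0 + 3) {xs. step_rel 0 xs} bs"
  let ?D = "steps level bs"
  have sP: "sorted_wrt (<) bs" "set bs \<subseteq> P"
    using sorted_wrt_subseq[OF bs(1) as(1)] set_subseq[OF bs(1)] as(2) by auto
  have D: "distinct_adj ?D" "set ?D \<subseteq> C" using steps_level_neq set_steps_level sP by auto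
  have triple: "\<exists>xs. subseq xs bs \<and> length xs = 3 \<and> (step_rel 0 xs \<longleftrightarrow> ?D ! i < ?D ! Suc i)"
    if "Suc i < length ?D" for i
  proof -
    let ?xs = "take (Suc 2) (drop i bs)"
    have sub: "subseq ?xs bs" by (rule subseq_order.trans[OF subseq_take subseq_drop])
    have len: "length ?xs = 3" using that by simp
    have "steps level ?xs ! 0 = ?D ! i" "steps level ?xs ! 1 = ?D ! Suc i"
      using that unfolding steps_take steps_drop by auto
    moreover have "list_all2 close ?xs ?xs" by (simp add: list_all2_refl)
    ultimately have "step_rel 0 ?xs \<longleftrightarrow> ?D ! i < ?D ! Suc i"
      using step_rel_0_close[of ?xs ?xs] sorted_wrt_subseq[OF sub sP(1)] set_subseq[OF sub] sP(2) len
      by (metis subset_trans)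
    then show ?thesis using sub len by blast
  qed
  have "(\<forall>i. Suc i < length ?D \<longrightarrow> ?D ! i < ?D ! Suc i) \<or>
        (\<forall>i. Suc i < length ?D \<longrightarrow> \<not> ?D ! i < ?D ! Suc i)"
    using bs(2) triple unfolding indiscernible_def add_0 mem_Collect_eq by metis
  then have "successively (<) ?D \<or> successively (>) ?D"
    using distinct_adj_nth[OF D(1)] unfolding successively_conv_nth by (meson linorder_neqE)
  then have "sorted_wrt (<) ?D \<or> sorted_wrt (<) (rev ?D)"
    by (auto simp: successively_conv_sorted_wrt sorted_wrt_rev)
  then have "distinct ?D" using strict_sorted_iff distinct_rev by metis
  then have "length ?D \<le> card C" using D(2) fin by (metis card_mono distinct_card)
  then show "real (length bs) \<le> card C + 1" by simp
qed

text \<open>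
  Peaks and valleys are visible to \<open>step_rel (Suc j)\<close> only at the start of a tuple of \<open>j + 4\<close> points.
  Therefore the last \<open>j\<close> points are set aside to complete four consecutive points to such
  a tuple, and the levels of the other points, having no peak or no valley, form two monotone runs.
\<close>

lemma indisc_bound_Suc:
  assumes cs: "set cs = C" "sorted_wrt (<) cs" "robust j cs" "indisc_bound j s cs"
    and as: "sorted_wrt (<) as" "set as \<subseteq> P"
  shows "indisc_bound (Suc j) (2 * max s (j + 3) + j + 1) as"
  unfolding indisc_bound_def
proof (intro allI impI; elim conjE)
  fix bs assume sub: "subseq bs as" and "indiscernible (Suc j + 3) {xs. step_rel (Suc j) xs} bs"
  then have hom: "indiscernible (j + 4) {xs. step_rel (Suc j) xs} bs"
    by (simp add: eval_nat_numeral)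
  have sP: "sorted_wrt (<) bs" "set bs \<subseteq> P"
    using sorted_wrt_subseq[OF sub as(1)] set_subseq[OF sub] as(2) by auto
  have len: "j + 4 \<le> length bs" using hom by (simp add: indiscernible_def)
  define ws where "ws = take (length bs - j) bs"
  define D where "D = steps level ws"
  have lenD: "length D = length bs - j - 1" by (simp add: D_def ws_def)
  have ws: "subseq ws bs" unfolding ws_def by (rule subseq_take)
  have wsP: "sorted_wrt (<) ws" "set ws \<subseteq> P"
    using sorted_wrt_subseq[OF ws sP(1)] set_subseq[OF ws] sP(2) by auto
  have D: "distinct_adj D" unfolding D_def by (rule steps_level_neq[OF wsP])
  have tuple: "\<exists>xs. subseq xs bs \<and> length xs = j + 4 \<and> steps level xs ! 0 = D ! i \<and>
      steps level xs ! 1 = D ! Suc i \<and> steps level xs ! 2 = D ! Suc (Suc i)"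
    if i: "Suc (Suc i) < length D" for i
  proof -
    \<comment> \<open>four consecutive points, completed by the points set aside\<close>
    let ?xs = "take 4 (drop i ws) @ drop (length bs - j) bs"
    have "subseq (take 4 (drop i ws)) ws"
      by (rule subseq_order.trans[OF subseq_take subseq_drop])
    then have "subseq ?xs (ws @ drop (length bs - j) bs)" by simp
    moreover have "ws @ drop (length bs - j) bs = bs" by (simp add: ws_def)
    moreover have len4: "length (take 4 (drop i ws)) = 4" "length ?xs = j + 4"
      using i lenD len by (auto simp: ws_def)
    moreover have "?xs ! t = ws ! (i + t)" if "t < 4" for t
      using that len4(1) i unfolding nth_append by (simp add: D_def)
    ultimately show ?thesis using i unfolding D_def
      by (intro exI[of _ ?xs]) (simp add: nth_steps numeral_2_eq_2)
  qed
  have eval: "step_rel (Suc j) xs \<longleftrightarrow> step_rel j (steps level xs) \<or> step_rel j (rev (steps level xs)) \<or>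
      (steps level xs ! 0 < steps level xs ! 1 \<and> steps level xs ! 2 < steps level xs ! 1)"
    if "subseq xs bs" "length xs = j + 4" for xs
    using that sorted_wrt_subseq[OF that(1) sP(1)] set_subseq[OF that(1)] sP(2)
    by (intro step_rel_Suc_close[OF cs(1-3)]) (auto simp: list_all2_refl)
  have peak: "\<exists>xs. subseq xs bs \<and> length xs = j + 4 \<and> step_rel (Suc j) xs"
    if "Suc (Suc i) < length D" "D ! i < D ! Suc i" "D ! Suc (Suc i) < D ! Suc i" for i
    using tuple[OF that(1)] that eval by metis
  have valley: "\<exists>xs. subseq xs bs \<and> length xs = j + 4 \<and> \<not> step_rel (Suc j) xs"
    if i: "Suc (Suc i) < length D" "D ! i > D ! Suc i" "D ! Suc (Suc i) > D ! Suc i" for i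
  proof -
    obtain xs where xs: "subseq xs bs" "length xs = j + 4" "steps level xs ! 0 = D ! i"
      "steps level xs ! 1 = D ! Suc i" "steps level xs ! 2 = D ! Suc (Suc i)"
      using tuple[OF i(1)] by blast
    have l: "length (steps level xs) = j + 3" using xs(2) by simp
    have "\<not> sorted_wrt (<) (steps level xs)" "\<not> sorted_wrt (>) (steps level xs)"
      using sorted_wrt_nth_less[of "(<)" "steps level xs" 0 1]
        sorted_wrt_nth_less[of "(>)" "steps level xs" 1 2] l xs(3-5) i(2,3) by fastforce+
    then have "\<not> step_rel j (steps level xs)" "\<not> step_rel j (rev (steps level xs))"
      using step_rel_sorted sorted_wrt_rev by metis+
    then have "\<not> step_rel (Suc j) xs" using eval[OF xs(1,2)] xs(3-5) i(2) by auto
    then show ?thesis using xs(1,2) by blast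
  qed
  have "(\<forall>i. Suc (Suc i) < length D \<longrightarrow> D ! i < D ! Suc i \<longrightarrow> \<not> D ! Suc (Suc i) < D ! Suc i) \<or>
        (\<forall>i. Suc (Suc i) < length D \<longrightarrow> D ! i > D ! Suc i \<longrightarrow> \<not> D ! Suc (Suc i) > D ! Suc i)"
    using hom peak valley unfolding indiscernible_def mem_Collect_eq by metis
  then have "\<exists>A B. D = A @ B \<and> (successively (>) A \<and> successively (<) B \<or>
      successively (<) A \<and> successively (>) B)"
  proof
    assume "\<forall>i. Suc (Suc i) < length D \<longrightarrow> D ! i < D ! Suc i \<longrightarrow> \<not> D ! Suc (Suc i) < D ! Suc i"
    then have "\<exists>A B. D = A @ B \<and> successively (>) A \<and> successively (<) B"
      by (intro split_if_no_turn D) auto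
    then show ?thesis by blast
  next
    assume "\<forall>i. Suc (Suc i) < length D \<longrightarrow> D ! i > D ! Suc i \<longrightarrow> \<not> D ! Suc (Suc i) > D ! Suc i"
    then have "\<exists>A B. D = A @ B \<and> successively (<) A \<and> successively (>) B"
      by (intro split_if_no_turn[where R = "(>)"] D) auto
    then show ?thesis by blast
  qed
  then obtain A B where AB: "D = A @ B"
    and "successively (>) A \<and> successively (<) B \<or> successively (<) A \<and> successively (>) B"
    by blast
  then have mono: "sorted_wrt (>) A \<and> sorted_wrt (<) B \<or> sorted_wrt (<) A \<and> sorted_wrt (>) B"
    by (simp add: successively_conv_sorted_wrt)
  have "steps level (take (Suc (length A)) ws) = A" "steps level (drop (length A) ws) = B"
    using AB unfolding steps_take steps_drop D_def by simp_all
  moreover have "subseq (take (Suc (length A)) ws) bs" "subseq (drop (length A) ws) bs"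
    using ws by (meson subseq_take subseq_drop subseq_order.trans)+
  ultimately have "real (length A) \<le> max s (j + 3)" "real (length B) \<le> max s (j + 3)"
    using mono inc_run_bound[OF cs sP hom] dec_run_bound[OF cs sP hom] by metis+
  then have "real (length A) + real (length B) \<le> 2 * max s (j + 3)"
    unfolding mult_2 by (rule add_mono)
  moreover have "real (length bs) = real (length A) + real (length B) + j + 1"
    using lenD len AB by simp
  ultimately show "real (length bs) \<le> 2 * max s (j + 3) + j + 1"
    by simp
qed

end

section \<open>Iterated logarithms\<close>

lemma filterlim_log_iter: "filterlim (log 2 ^^ j) at_top (at_top :: real filter)"
proof (induction j)
  case (Suc j)
  have "filterlim (log 2 :: real \<Rightarrow> real) at_top at_top"
    using filterlim_tendsto_pos_mult_at_top[OF tendsto_const _ ln_at_top, of "1 / ln 2"]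
    by (simp add: log_def[abs_def])
  from filterlim_compose[OF this Suc] show ?case by (simp add: comp_def)
qed (simp add: filterlim_ident id_def)

text \<open>
  Rounding the number of levels up to an integer costs at most \<open>1\<close> after any number of logarithms:
  \<open>log 2 (t + 1) \<le> log 2 (2 * t) = log 2 t + 1\<close> for \<open>t \<ge> 1\<close>.
\<close>

lemma log_iter_add_one:
  "\<exists>X. \<forall>x\<ge>X. 1 \<le> (log 2 ^^ j) x \<and> (\<forall>y. x \<le> y \<longrightarrow> y \<le> x + 1 \<longrightarrow> (log 2 ^^ j) y \<le> (log 2 ^^ j) x + 1 \<and>
     (log 2 ^^ j) x \<le> ((log 2 ^^ j) y :: real))"
proof (induction j)
  case 0
  show ?case by (intro exI[of _ 1]) simp
next
  case (Suc j)
  let ?L = "(log 2 ^^ j) :: real \<Rightarrow> real"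
  obtain X where X: "\<And>x. X \<le> x \<Longrightarrow> 1 \<le> ?L x"
    "\<And>x y. X \<le> x \<Longrightarrow> x \<le> y \<Longrightarrow> y \<le> x + 1 \<Longrightarrow> ?L y \<le> ?L x + 1 \<and> ?L x \<le> ?L y"
    using Suc.IH by blast
  obtain Y where Y: "\<And>x. Y \<le> x \<Longrightarrow> 1 \<le> log 2 (?L x)"
    using filterlim_log_iter[of "Suc j"] unfolding filterlim_at_top eventually_at_top_linorder
    by (metis comp_apply funpow.simps(2))
  have "log 2 (?L y) \<le> log 2 (?L x) + 1 \<and> log 2 (?L x) \<le> log 2 (?L y)"
    if "max X Y \<le> x" "x \<le> y" "y \<le> x + 1" for x y
  proof -
    have x: "1 \<le> ?L x" and y: "?L y \<le> ?L x + 1" "?L x \<le> ?L y" using X[of x] X(2)[of x y] that by auto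
    have "log 2 (?L y) \<le> log 2 (2 * ?L x)" using x y by simp
    also have "\<dots> = log 2 (?L x) + 1" using x by (subst log_mult) auto
    finally show ?thesis using x y by simp
  qed
  then show ?case using Y by (intro exI[of _ "max X Y"]) auto
qed

lemma log2_ceiling:
  assumes "2 \<le> n"
  obtains m :: nat where "n \<le> 2 ^ m" "log 2 (real n) \<le> m" "m \<le> log 2 (real n) + 1"
proof (rule that)
  let ?m = "nat \<lceil>log 2 (real n)\<rceil>"
  have pos: "0 \<le> log 2 (real n)" using assms by simp
  show m: "log 2 (real n) \<le> ?m" "?m \<le> log 2 (real n) + 1"
    using pos by linarith+
  have "real n = 2 powr log 2 (real n)" using assms by simp
  also have "\<dots> \<le> 2 powr ?m" using m(1) by simp
  also have "\<dots> = real (2 ^ ?m)" by (simp add: powr_realpow)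
  finally show "n \<le> 2 ^ ?m" by (simp only: of_nat_le_iff)
qed

section \<open>Sequences with short indiscernible subsequences\<close>

text \<open>
  To obtain \<open>n\<close> points take about \<open>log 2 n\<close> levels, which form a sequence for the previous relation.
\<close>

lemma short_indiscernibles_exist:
  "\<exists>C>0. \<exists>N. \<forall>n>N. \<exists>as s. length as = n \<and> spaced as \<and> robust j as \<and> indisc_bound j s as \<and>
     s \<le> C * (log 2 ^^ Suc j) (real n)"
proof (induction j)
  case 0
  have "\<exists>as s. length as = n \<and> spaced as \<and> robust 0 as \<and> indisc_bound 0 s as \<and>
     s \<le> 3 * (log 2 ^^ Suc 0) (real n)" if "n > 1" for n :: nat
  proof -
    have "2 \<le> n" using that by simp
    then obtain m :: nat where m: "n \<le> 2 ^ m" "log 2 (real n) \<le> m" "m \<le> log 2 (real n) + 1"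
      by (rule log2_ceiling)
    \<comment> \<open>for triples any spaced list of levels will do\<close>
    define cs where "cs = map (\<lambda>i. 4 * real (Suc i)) [0..<m]"
    have "spaced cs" "n \<le> 2 ^ length cs"
      using m(1) by (auto simp: cs_def spaced_def sorted_wrt_iff_nth_less)
    then obtain as where as: "length as = n" "spaced as" "levels (set cs) (set as)"
      by (rule levels_spaced_exist)
    interpret levels "set cs" "set as" by (rule as(3))
    have "card (set cs) \<le> m" using card_length[of cs] by (simp add: cs_def)
    moreover have "1 \<le> log 2 (real n)" using that by simp
    ultimately have "real (card (set cs)) + 1 \<le> 3 * (log 2 ^^ Suc 0) (real n)"
      using m(3) by simp
    then show ?thesis
      using as(1,2) robust_0[OF spaced_sorted[OF as(2)]] indisc_bound_0[OF _ spaced_sorted[OF as(2)]]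
      by (intro exI[of _ as] exI[of _ "real (card (set cs)) + 1"]) (simp add: add.commute)
  qed
  then show ?case by (intro exI[of _ 3] conjI exI[of _ 1]) auto
next
  case (Suc j)
  let ?L = "log 2 ^^ Suc j :: real \<Rightarrow> real"
  have L_Suc: "(log 2 ^^ Suc (Suc j)) x = ?L (log 2 x)" for x
    by (simp only: funpow_Suc_right comp_apply)
  obtain C N where C: "C > 0" and IH: "\<And>n. n > N \<Longrightarrow> \<exists>as s. length as = n \<and> spaced as \<and>
      robust j as \<and> indisc_bound j s as \<and> s \<le> C * ?L (real n)"
    using Suc.IH by blast
  obtain X where X: "\<And>x. X \<le> x \<Longrightarrow> 1 \<le> ?L x"
    "\<And>x y. X \<le> x \<Longrightarrow> x \<le> y \<Longrightarrow> y \<le> x + 1 \<Longrightarrow> ?L y \<le> ?L x + 1"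
    using log_iter_add_one[of "Suc j"] by blast
  \<comment> \<open>With \<open>t = log 2 n\<close>, the bound for the levels is \<open>s \<le> C * (?L t + 1) \<le> 2 * C * ?L t\<close>, and the
    step turns it into \<open>2 * max s (j + 3) + j + 1\<close>; the constants are absorbed by \<open>?L t \<ge> 1\<close>.\<close>
  let ?C' = "4 * C + 3 * (real j + 3)"
  define M where "M = max 1 (max X (real N + 1))"
  define N' where "N' = nat \<lceil>2 powr M\<rceil>"
  have "\<exists>as s. length as = n \<and> spaced as \<and> robust (Suc j) as \<and> indisc_bound (Suc j) s as \<and>
     s \<le> ?C' * (log 2 ^^ Suc (Suc j)) (real n)" if n: "n > N'" for n :: nat
  proof -
    let ?x = "log 2 (real n)"
    have "2 powr M \<le> real n" using n unfolding N'_def by linarith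
    moreover have "0 < real n" using n by simp
    ultimately have "M \<le> ?x" by (simp add: le_log_iff)
    then have x: "1 \<le> ?x" "X \<le> ?x" "real N + 1 \<le> ?x" by (simp_all add: M_def)
    then have "2 \<le> n" using \<open>0 < real n\<close> by simp
    then obtain m :: nat where m: "n \<le> 2 ^ m" "?x \<le> m" "m \<le> ?x + 1"
      by (rule log2_ceiling)
    have "m > N" using m(2) x by simp
    then obtain cs s where cs: "length cs = m" "spaced cs" "robust j cs" "indisc_bound j s cs"
      and s: "s \<le> C * ?L (real m)"
      using IH by blast
    have "n \<le> 2 ^ length cs" using m(1) cs(1) by simp
    with cs(2) obtain as where as: "length as = n" "spaced as" "levels (set cs) (set as)"
      by (rule levels_spaced_exist)
    interpret levels "set cs" "set as" by (rule as(3))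
    note sorted = spaced_sorted[OF cs(2)] spaced_sorted[OF as(2)]
    have L: "1 \<le> ?L ?x" "?L (real m) \<le> ?L ?x + 1" using X(1)[of ?x] X(2)[of ?x m] x m by auto
    have "C * ?L (real m) \<le> C * (2 * ?L ?x)" using C L by (intro mult_left_mono) auto
    moreover have "real j + 3 \<le> (real j + 3) * ?L ?x" using L(1) by (simp add: mult_le_cancel_left1)
    moreover have "0 \<le> C * ?L ?x" using C L(1) by simp
    ultimately have "2 * max s (real j + 3) + real j + 1 \<le> ?C' * ?L ?x"
      using s by (simp add: algebra_simps max_def)
    then show ?thesis unfolding L_Suc
      using as(1,2) robust_Suc[OF refl sorted(1) cs(3) sorted(2)]
        indisc_bound_Suc[OF refl sorted(1) cs(3,4) sorted(2)]
      by (intro exI[of _ as] exI[of _ "2 * max s (real j + 3) + real j + 1"]) simp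
  qed
  moreover have "?C' > 0" using C by simp
  ultimately show ?case by blast
qed

theorem theorem1p13:
  fixes k :: nat
  assumes "k \<ge> 3"
  shows "\<exists>(E :: real list set) (C :: real) (N :: nat).
    definable_in_Rexp k E \<and> C > 0 \<and>
    (\<forall>n > N. \<exists>as :: real list. length as = n \<and>
      \<not> (\<exists>bs. subseq bs as \<and> indiscernible k E bs \<and>
            real (length bs) > C * (log 2 ^^ (k - 2)) (real n)))"
proof -
  obtain j where k: "k = j + 3" using assms by (metis add.commute le_Suc_ex)
  have k2: "k - 2 = Suc j" using k by simp
  obtain C N where C: "C > 0" and few: "\<And>n. n > N \<Longrightarrow> \<exists>as s. length as = n \<and> spaced as \<and>
      robust j as \<and> indisc_bound j s as \<and> s \<le> C * (log 2 ^^ Suc j) (real n)"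
    using short_indiscernibles_exist[of j] by blast
  have "\<exists>as :: real list. length as = n \<and>
      \<not> (\<exists>bs. subseq bs as \<and> indiscernible k {xs. step_rel j xs} bs \<and>
            real (length bs) > C * (log 2 ^^ (k - 2)) (real n))" if "n > N" for n
    using few[OF that] unfolding indisc_bound_def k2 k by fastforce
  then show ?thesis using definable_in_Rexp_step_rel[of j] C unfolding k[symmetric] by blast
qed

end
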